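(* Let $N$ be a proper element of a multiplication lattice $L$-module $M$. Then the following statements are equivalent: (1) $N$ is a classical prime element of $M$. (2) $(N:B)=(N:I_M)$ for every proper element $B\in M$ such that $B>N$. (3) $(N:X)=(N:I_M)$ for every $X\in M$ with $X\not\leqslant N$. (4) $N=(N:a)$ for every proper element $a\in L$ such that $(N:I_M)<a$.
   Context: A multiplicative lattice $L$ is a complete lattice (least element $0$, greatest element $1$) with a commutative, associative multiplication that distributes over arbitrary joins and has $1$ as identity. An element $a$ of a complete lattice is compact if $a\leqslant \bigvee X$ implies $a\leqslant x_1\vee\cdots\vee x_n$ for finitely many $x_i\in X$. Standing assumption: every element of $L$ is a join of compact elements of $L$, $1$ is compact, and finite products of compact elements of $L$ are compact. An element $a\in L$ is proper if $a<1$. An $L$-module $M$ is a complete lattice (least element $O_M$, greatest element $I_M$) with a multiplication $L\times M\to M$, $(a,A)\mapsto aA$, such that $(\bigvee_\alpha a_\alpha)A=\bigvee_\alpha a_\alpha A$, $a(\bigvee_\alpha A_\alpha)=\bigvee_\alpha aA_\alpha$, $(ab)A=a(bA)$, $1A=A$, $0A=O_M$. For $A,B\in M$ and $a\in L$, $(A:B)=\bigvee\{x\in L\mid xB\leqslant A\}\in L$ and $(A:a)=\bigvee\{X\in M\mid aX\leqslant A\}\in M$. $M$ is a multiplication lattice $L$-module if every $N\in M$ has the form $N=aI_M$ with $a\in L$. $N\in M$ is proper if $N<I_M$. A proper $N\in M$ is classical prime if for all $K\in M$, $a,b\in L$, $abK\leqslant N$ implies $aK\leqslant N$ or $bK\leqslant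 N$. *)

theory Defs
  imports Main
begin

text \<open>
  The empty subset is allowed, so that \<open>bot\<close> is always compact.
\<close>

definition (in complete_lattice) compact_element :: "'a \<Rightarrow> bool"
  where "compact_element a \<longleftrightarrow>
    (\<forall>X. a \<le> Sup X \<longrightarrow> (\<exists>F. finite F \<and> F \<subseteq> X \<and> a \<le> Sup F))"

class multiplicative_lattice = complete_lattice + comm_monoid_mult +
  assumes one_eq_top: "1 = top"
    and mult_Sup_distrib: "a * Sup X = (SUP x\<in>X. a * x)"

text \<open>
  The standing assumption on the scalars: compactly generated, with compact unit and with
  the compact elements closed under finite products.
\<close>

class compactly_generated_multiplicative_lattice = multiplicative_lattice +
  assumes join_of_compact: "\<exists>X. (\<forall>x\<in>X. compact_element x) \<and> a = Sup X"
    and compact_one: "compact_element 1"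
    and compact_prod_list: "(\<forall>x\<in>set xs. compact_element x) \<Longrightarrow> compact_element (prod_list xs)"

locale lattice_module =
  fixes act :: "'l::compactly_generated_multiplicative_lattice \<Rightarrow> 'm::complete_lattice \<Rightarrow> 'm"
    (infixr "\<odot>" 75)
  assumes Sup_act: "Sup X \<odot> A = (SUP x\<in>X. x \<odot> A)"
    and act_Sup: "a \<odot> Sup Y = (SUP A\<in>Y. a \<odot> A)"
    and mult_act: "(a * b) \<odot> A = a \<odot> (b \<odot> A)"
    and one_act: "1 \<odot> A = A"
    and bot_act: "bot \<odot> A = bot"

locale multiplication_lattice_module = lattice_module +
  assumes multiplication: "\<exists>a. N = a \<odot> top"

text \<open>
  The two residuals written \<open>(A : B)\<close> and \<open>(A : a)\<close>: the first divides by an element of the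
  module and lies in the lattice of scalars, the second divides by a scalar and lies in
  the module.
\<close>

definition residual :: "('l::complete_lattice \<Rightarrow> 'm::complete_lattice \<Rightarrow> 'm) \<Rightarrow> 'm \<Rightarrow> 'm \<Rightarrow> 'l"
  where "residual act A B = Sup {x. act x B \<le> A}"

definition scalar_residual :: "('l::complete_lattice \<Rightarrow> 'm::complete_lattice \<Rightarrow> 'm) \<Rightarrow> 'm \<Rightarrow> 'l \<Rightarrow> 'm"
  where "scalar_residual act A a = Sup {X. act a X \<le> A}"

definition proper :: "'a::complete_lattice \<Rightarrow> bool"
  where "proper a \<longleftrightarrow> a < top"

definition classical_prime ::
    "('l::multiplicative_lattice \<Rightarrow> 'm::complete_lattice \<Rightarrow> 'm) \<Rightarrow> 'm \<Rightarrow> bool"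
  where "classical_prime act N \<longleftrightarrow> proper N \<and>
    (\<forall>K a b. act (a * b) K \<le> N \<longrightarrow> act a K \<le> N \<or> act b K \<le> N)"

end

theory Submission imports Defs begin

text \<open>
  In a multiplication module an element \<open>X = c \<odot> top\<close> satisfies \<open>x \<odot> X = (x * c) \<odot> top\<close>,
  so classical primeness is the same as primeness: \<open>x \<odot> X \<le> N\<close> forces \<open>X \<le> N\<close> or
  \<open>x \<odot> top \<le> N\<close>, which is (3). The restricted tests (2) and (4) suffice because \<open>X\<close> may be
  replaced by \<open>sup N X\<close> without changing \<open>(N : X)\<close>, and a scalar \<open>x\<close> with \<open>x \<odot> X \<le> N\<close> by
  \<open>sup (N : top) x\<close>; if one of these joins is \<open>top\<close>, the claim is immediate.
\<close>

context lattice_module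
begin

lemma sup_act: "sup a b \<odot> A = sup (a \<odot> A) (b \<odot> A)"
  using Sup_act[of "{a, b}" A] by simp

lemma act_sup: "a \<odot> sup A B = sup (a \<odot> A) (a \<odot> B)"
  using act_Sup[of a "{A, B}"] by simp

lemma act_mono_left: "a \<le> b \<Longrightarrow> a \<odot> A \<le> b \<odot> A"
  by (metis sup_act le_iff_sup)

lemma act_mono_right: "A \<le> B \<Longrightarrow> a \<odot> A \<le> a \<odot> B"
  by (metis act_sup le_iff_sup)

lemma act_le: "a \<odot> A \<le> A"
  by (metis act_mono_left one_act one_eq_top top_greatest)

text \<open>The action preserves joins of scalars, so the join defining the residual is attained.
  This makes \<open>residual\<close> a right adjoint and replaces suprema by plain inequalities in
  what follows.\<close>

lemma le_residual_iff: "x \<le> residual (\<odot>) A B \<longleftrightarrow> x \<odot> B \<le> A"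
proof
  assume "x \<le> residual (\<odot>) A B"
  then have "x \<odot> B \<le> residual (\<odot>) A B \<odot> B" by (rule act_mono_left)
  also have "\<dots> \<le> A" unfolding residual_def Sup_act by (auto intro: SUP_least)
  finally show "x \<odot> B \<le> A" .
qed (auto simp: residual_def intro: Sup_upper)

lemma le_scalar_residual_iff: "X \<le> scalar_residual (\<odot>) A a \<longleftrightarrow> a \<odot> X \<le> A"
proof
  assume "X \<le> scalar_residual (\<odot>) A a"
  then have "a \<odot> X \<le> a \<odot> scalar_residual (\<odot>) A a" by (rule act_mono_right)
  also have "\<dots> \<le> A" unfolding scalar_residual_def act_Sup by (auto intro: SUP_least)
  finally show "a \<odot> X \<le> A" .
qed (auto simp: scalar_residual_def intro: Sup_upper)

lemma residual_top_le: "residual (\<odot>) N top \<le> residual (\<odot>) N X"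
  by (meson act_mono_right le_residual_iff order_refl order_trans top_greatest)

text \<open>Every scalar sends \<open>N\<close> below \<open>N\<close>, so joining \<open>N\<close>
  to \<open>X\<close> adds no condition on the scalars.\<close>

lemma residual_sup: "residual (\<odot>) N (sup N X) = residual (\<odot>) N X"
  by (rule order_antisym) (metis act_le act_sup le_residual_iff le_sup_iff order_refl)+

text \<open>One inequality always holds, by \<open>residual_top_le\<close>; the right-hand side
  tests the other one scalar by scalar.\<close>

lemma residual_eq_top_iff:
  "residual (\<odot>) N X = residual (\<odot>) N top \<longleftrightarrow> (\<forall>x. x \<odot> X \<le> N \<longrightarrow> x \<odot> top \<le> N)"
  by (metis le_residual_iff order_antisym order_refl residual_top_le)

lemma residual_above_iff:
  "(\<forall>B. proper B \<and> N < B \<longrightarrow> residual (\<odot>) N B = residual (\<odot>) N top) \<longleftrightarrow>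
   (\<forall>X. \<not> X \<le> N \<longrightarrow> residual (\<odot>) N X = residual (\<odot>) N top)"
proof (intro iffI allI impI)
  fix X
  assume above: "\<forall>B. proper B \<and> N < B \<longrightarrow> residual (\<odot>) N B = residual (\<odot>) N top"
    and "\<not> X \<le> N"
  then have "N < sup N X" by (simp add: less_le_not_le)
  \<comment> \<open>If the join is not proper, it equals \<open>top\<close> and both sides
    coincide.\<close>
  with above have "residual (\<odot>) N (sup N X) = residual (\<odot>) N top"
    by (metis proper_def top.not_eq_extremum)
  then show "residual (\<odot>) N X = residual (\<odot>) N top" by (simp only: residual_sup)
qed (auto dest: leD)

lemma residual_eq_iff_scalar_residual:
  "(\<forall>X. \<not> X \<le> N \<longrightarrow> residual (\<odot>) N X = residual (\<odot>) N top) \<longleftrightarrow>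
   (\<forall>a. proper a \<and> residual (\<odot>) N top < a \<longrightarrow> N = scalar_residual (\<odot>) N a)"
proof (intro iffI allI impI)
  fix a
  assume "\<forall>X. \<not> X \<le> N \<longrightarrow> residual (\<odot>) N X = residual (\<odot>) N top"
    and "proper a \<and> residual (\<odot>) N top < a"
  \<comment> \<open>Otherwise \<open>a\<close> would lie below the residual of \<open>N\<close> by
    \<open>X\<close>, which equals the one by \<open>top\<close>, although \<open>a\<close> is
    strictly above the latter.\<close>
  then have "X \<le> N" if "a \<odot> X \<le> N" for X
    using that by (metis le_residual_iff leD)
  then show "N = scalar_residual (\<odot>) N a"
    by (metis act_le le_scalar_residual_iff order_antisym order_refl)
next
  fix X
  assume scalar: "\<forall>a. proper a \<and> residual (\<odot>) N top < a \<longrightarrow> N = scalar_residual (\<odot>) N a"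
    and X: "\<not> X \<le> N"
  have "x \<le> residual (\<odot>) N top" if "x \<odot> X \<le> N" for x
  proof (rule ccontr)
    let ?a = "sup (residual (\<odot>) N top) x"
    assume "\<not> x \<le> residual (\<odot>) N top"
    then have "residual (\<odot>) N top < ?a" by (simp add: less_le_not_le)
    \<comment> \<open>Both joinands lie below the residual of \<open>N\<close> by
      \<open>X\<close>.\<close>
    moreover have "?a \<odot> X \<le> N"
      using that residual_top_le by (simp flip: le_residual_iff)
    \<comment> \<open>For proper \<open>?a\<close> this is \<open>scalar\<close> with the
      adjunction; for \<open>?a = 1\<close> the action on \<open>X\<close> is the identity.\<close>
    ultimately have "X \<le> N"
      using scalar by (metis le_scalar_residual_iff one_act one_eq_top proper_def top.not_eq_extremum)
    with X show False ..
  qed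
  then show "residual (\<odot>) N X = residual (\<odot>) N top"
    by (simp add: residual_eq_top_iff le_residual_iff)
qed

end

lemma (in multiplication_lattice_module) classical_prime_iff_residual:
  assumes "proper N"
  shows "classical_prime (\<odot>) N \<longleftrightarrow>
    (\<forall>X. \<not> X \<le> N \<longrightarrow> residual (\<odot>) N X = residual (\<odot>) N top)"
proof
  assume prime: "classical_prime (\<odot>) N"
  show "\<forall>X. \<not> X \<le> N \<longrightarrow> residual (\<odot>) N X = residual (\<odot>) N top"
    unfolding residual_eq_top_iff
  proof (intro allI impI)
    fix X x
    assume "\<not> X \<le> N" and "x \<odot> X \<le> N"
    moreover obtain c where "X = c \<odot> top" using multiplication by blast
    \<comment> \<open>Primeness is applied to the product \<open>x * c\<close> with
      \<open>K = top\<close>.\<close>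
    ultimately show "x \<odot> top \<le> N"
      using prime by (metis classical_prime_def mult_act)
  qed
next
  assume residual: "\<forall>X. \<not> X \<le> N \<longrightarrow> residual (\<odot>) N X = residual (\<odot>) N top"
  \<comment> \<open>If \<open>b \<odot> K\<close> is not below \<open>N\<close>, then
    \<open>a\<close> lies below the residual by \<open>b \<odot> K\<close>, hence below the one by
    \<open>top\<close>, hence below the one by \<open>K\<close>.\<close>
  have "a \<odot> K \<le> N \<or> b \<odot> K \<le> N" if "(a * b) \<odot> K \<le> N" for K a b
    using that residual
    by (metis mult_act le_residual_iff residual_top_le order_trans)
  with assms show "classical_prime (\<odot>) N" by (simp add: classical_prime_def)
qed

theorem theorem3p3:
  fixes act :: "'l::compactly_generated_multiplicative_lattice \<Rightarrow> 'm::complete_lattice \<Rightarrow> 'm"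
    and N :: 'm
  assumes "multiplication_lattice_module act"
    and "proper N"
  shows "(classical_prime act N \<longleftrightarrow>
      (\<forall>B. proper B \<and> N < B \<longrightarrow> residual act N B = residual act N top))
    \<and> ((\<forall>B. proper B \<and> N < B \<longrightarrow> residual act N B = residual act N top) \<longleftrightarrow>
      (\<forall>X. \<not> X \<le> N \<longrightarrow> residual act N X = residual act N top))
    \<and> ((\<forall>X. \<not> X \<le> N \<longrightarrow> residual act N X = residual act N top) \<longleftrightarrow>
      (\<forall>a. proper a \<and> residual act N top < a \<longrightarrow> N = scalar_residual act N a))"
proof -
  interpret multiplication_lattice_module act by fact
  show ?thesis
    using classical_prime_iff_residual[OF assms(2)] residual_above_iff[of N]
      residual_eq_iff_scalar_residual[of N]
    by argo
qed

end
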